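(* Let $A \in \mathbb{R}^{m \times n}$ have full column rank and let $b \in \mathbb{R}^m$. Let $x = (A^t A)^{-1} A^t b$ be the solution and $r = b - Ax$ the residual of the linear least squares problem $\min_u \|b - Au\|_2$, and assume $x \ne 0$ and $r \neq 0$. Let $\sigma_{\min}$ be the smallest singular value of $A$, let $\kappa_2 = \|A\|_2/\sigma_{\min}$, let $v = \|Ax\|_2/(\|x\|_2\,\sigma_{\min})$, and let $\theta$ be the angle between $b$ and the column space of $A$ (so $\tan(\theta) = \|r\|_2/\|Ax\|_2$). Let $\chi_{Ax}(b)$ and $\chi_{Ax}(A)$ be the condition numbers of the orthogonal projection $Ax$ of $b$ into the column space of $A$, with respect to $b$ and with respect to $A$, for the scaled norms $\|\Delta A\|_2/\|A\|_2$, $\|\Delta b\|_2/\|b\|_2$, and $\|\Delta(Ax)\|_2/\|Ax\|_2$. Then $$\chi_{Ax}(b) = \sec(\theta), \qquad \frac{1}{\sqrt 2}\,\kappa_2\sqrt{\tan^2(\theta) + \frac{1}{v^2}} \;\le\; \chi_{Ax}(A) \;\le\; \kappa_2 \sqrt{\tan^2(\theta) + \frac{1}{v^2}}.$$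
   Context: For vectors $\|\cdot\|_2$ is the Euclidean norm; for matrices $\|\cdot\|_2$ is the spectral norm (largest singular value). The orthogonal projection is regarded as a function $p(A,b) = A(A^tA)^{-1}A^t\,b$ (which equals $Ax$) on pairs with $A \in \mathbb{R}^{m\times n}$ of full column rank and $b \in \mathbb{R}^m$. The condition numbers are the induced operator norms of its partial derivatives (Jacobian matrices) at the given $(A,b)$. Let $J_{Ax}(b): \mathbb{R}^m \to \mathbb{R}^m$ be the derivative of $p$ with respect to $b$ with $A$ held fixed, and $J_{Ax}(A): \mathbb{R}^{m \times n} \to \mathbb{R}^m$ the derivative of $p$ with respect to (the entries of) $A$ with $b$ held fixed. Then $$\chi_{Ax}(b) = \max_{\Delta b \ne 0} \frac{\|J_{Ax}(b)\,\Delta b\|_2/\|Ax\|_2}{\|\Delta b\|_2/\|b\|_2}, \qquad \chi_{Ax}(A) = \max_{\Delta A \neq 0} \frac{\|J_{Ax}(A)[\Delta A]\|_2/\|Ax\|_2}{\|\Delta A\|_2/\|A\|_2},$$ where $\Delta b \in \mathbb{R}^m$, $\Delta A \in \mathbb{R}^{m \times n}$. The scale factors $\|A\|_2$, $\|b\|_2$, $\|Ax\|_2$ are constants evaluated at the given problem (not differentiated). *)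

theory Defs
  imports "HOL-Analysis.Analysis"
begin

section \<open>Singular values and the spectral norm\<close>

text \<open>A matrix in \<open>\<real>\<^bsup>m \<times> n\<^esup>\<close> is an element of \<^typ>\<open>real^'n^'m\<close>. The singular values are the square
  roots of the eigenvalues of \<open>A\<^sup>t A\<close>. If \<open>m < n\<close> this set also contains \<open>0\<close>, which does not
  affect the largest one; \<open>singular_min\<close> is only meant for \<open>m \<ge> n\<close>, as is the case for
  matrices of full column rank.\<close>

definition singular_values :: "real^'n^'m \<Rightarrow> real set" where
  "singular_values A =
     {s. s \<ge> 0 \<and> (\<exists>u. u \<noteq> 0 \<and> (transpose A ** A) *v u = s\<^sup>2 *\<^sub>R u)}"

definition spectral_norm :: "real^'n^'m \<Rightarrow> real" where
  "spectral_norm A = (GREATEST s. s \<in> singular_values A)"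

definition singular_min :: "real^'n^'m \<Rightarrow> real" where
  "singular_min A = (LEAST s. s \<in> singular_values A)"

section \<open>Least squares and the orthogonal projection\<close>

definition lsq_solution :: "real^'n^'m \<Rightarrow> real^'m \<Rightarrow> real^'n" where
  "lsq_solution A b = matrix_inv (transpose A ** A) *v (transpose A *v b)"

definition lsq_projection :: "real^'n^'m \<Rightarrow> real^'m \<Rightarrow> real^'m" where
  "lsq_projection A b = (A ** matrix_inv (transpose A ** A) ** transpose A) *v b"

section \<open>Angles\<close>

definition vec_angle :: "'a::real_inner \<Rightarrow> 'a \<Rightarrow> real" where
  "vec_angle u w = arccos (inner u w / (norm u * norm w))"

text \<open>The angle between a vector and a subspace is the smallest angle it makes with a nonzero
  vector of the subspace.\<close>

definition subspace_angle :: "'a::real_inner \<Rightarrow> 'a set \<Rightarrow> real" where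
  "subspace_angle b S = (LEAST t. \<exists>w\<in>S. w \<noteq> 0 \<and> t = vec_angle b w)"

section \<open>Condition numbers of the projection\<close>

text \<open>The Jacobians are the Frechet derivatives of the two partial maps. Full column rank is an open
  condition, so near such an \<open>A\<close> the value of \<^const>\<open>matrix_inv\<close> at singular matrices plays no role.\<close>

definition J_b :: "real^'n^'m \<Rightarrow> real^'m \<Rightarrow> real^'m \<Rightarrow> real^'m" where
  "J_b A b = frechet_derivative (\<lambda>c. lsq_projection A c) (at b)"

definition J_A :: "real^'n^'m \<Rightarrow> real^'m \<Rightarrow> real^'n^'m \<Rightarrow> real^'m" where
  "J_A A b = frechet_derivative (\<lambda>M. lsq_projection M b) (at A)"

definition chi_b :: "real^'n^'m \<Rightarrow> real^'m \<Rightarrow> real" where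
  "chi_b A b = (GREATEST c. \<exists>\<Delta>b. \<Delta>b \<noteq> 0 \<and>
     c = (norm (J_b A b \<Delta>b) / norm (A *v lsq_solution A b)) / (norm \<Delta>b / norm b))"

definition chi_A :: "real^'n^'m \<Rightarrow> real^'m \<Rightarrow> real" where
  "chi_A A b = (GREATEST c. \<exists>\<Delta>A. \<Delta>A \<noteq> 0 \<and>
     c = (norm (J_A A b \<Delta>A) / norm (A *v lsq_solution A b))
         / (spectral_norm \<Delta>A / spectral_norm A))"

section \<open>Consistency of the definitions\<close>

lemma psd_kernel:
  fixes B :: "'a::real_inner \<Rightarrow> 'a"
  assumes lin: "linear B" and sa: "\<And>x y. inner (B x) y = inner x (B y)"
    and psd: "\<And>x. inner (B x) x \<ge> 0" and z: "inner (B u) u = 0"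
  shows "B u = 0"
proof -
  define a where "a = inner (B u) (B u)"
  define c where "c = inner (B (B u)) (B u)"
  have ineq: "2 * t * a \<le> t\<^sup>2 * c" for t
  proof -
    have "0 \<le> inner (B (u - t *\<^sub>R B u)) (u - t *\<^sub>R B u)"
      by (rule psd)
    also have "\<dots> = - 2 * t * a + t\<^sup>2 * c"
      by (simp add: linear_diff[OF lin] linear_scale[OF lin] inner_diff_left inner_diff_right
          z sa[of "B u" u] a_def c_def power2_eq_square algebra_simps)
    finally show ?thesis by simp
  qed
  have c0: "c \<ge> 0" using psd c_def by simp
  have a0: "a \<ge> 0" by (simp add: a_def)
  have "a = 0"
  proof (cases "c = 0")
    case True
    then show ?thesis using ineq[of 1] a0 by simp
  next
    case False
    then have cp: "c > 0" using c0 by simp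
    have "2 * a\<^sup>2 / c \<le> a\<^sup>2 / c"
      using ineq[of "a / c"] cp by (simp add: power2_eq_square field_simps)
    then have "a\<^sup>2 \<le> 0" using cp by (simp add: divide_le_cancel)
    then show ?thesis by simp
  qed
  then show ?thesis by (simp add: a_def)
qed

lemma gram_inner:
  fixes A :: "real^'n^'m"
  shows "inner ((transpose A ** A) *v x) y = inner (A *v x) (A *v y)"
  by (metis dot_lmul_matrix inner_commute matrix_vector_mul_assoc transpose_matrix_vector)

lemma singular_value_attained:
  fixes A :: "real^'n^'m"
  assumes "s \<in> singular_values A"
  obtains u where "norm u = 1" "norm (A *v u) = s"
proof -
  from assms obtain u where s: "s \<ge> 0" and u: "u \<noteq> 0"
    and e: "(transpose A ** A) *v u = s\<^sup>2 *\<^sub>R u"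
    by (auto simp: singular_values_def)
  have "(norm (A *v u))\<^sup>2 = (s * norm u)\<^sup>2"
    using gram_inner[of A u u] by (simp add: e power_mult_distrib power2_norm_eq_inner)
  then have n: "norm (A *v u) = s * norm u"
    using s by (simp add: power2_eq_iff_nonneg)
  show ?thesis
  proof
    show "norm (u /\<^sub>R norm u) = 1" using u by simp
    show "norm (A *v (u /\<^sub>R norm u)) = s"
      using u n by (simp add: linear_scale[OF matrix_vector_mul_linear])
  qed
qed

lemma sphere_scale:
  fixes A :: "real^'n^'m"
  shows "norm (A *v x) = norm (A *v (x /\<^sub>R norm x)) * norm x"
  by (cases "x = 0") (simp_all add: linear_scale[OF matrix_vector_mul_linear])

lemma extremal_singular_value:
  fixes A :: "real^'n^'m"
  assumes u: "norm u = 1"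
    and ext: "(\<forall>w. norm w = 1 \<longrightarrow> norm (A *v w) \<le> norm (A *v u)) \<or>
              (\<forall>w. norm w = 1 \<longrightarrow> norm (A *v u) \<le> norm (A *v w))"
  shows "norm (A *v u) \<in> singular_values A"
proof -
  define l where "l = (norm (A *v u))\<^sup>2"
  define e :: real where "e = (if \<forall>w. norm w = 1 \<longrightarrow> norm (A *v w) \<le> norm (A *v u) then 1 else - 1)"
  have e0: "e \<noteq> 0" by (simp add: e_def)
  define B where "B x = e *\<^sub>R (l *\<^sub>R x - (transpose A ** A) *v x)" for x
  have lin: "linear B"
    unfolding B_def
    by (intro linear_compose_scale_right linear_compose_sub linear_ident matrix_vector_mul_linear)
  have inB: "inner (B x) y = e * (l * inner x y - inner (A *v x) (A *v y))" for x y
    by (simp add: B_def inner_diff_left gram_inner)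
  have sa: "inner (B x) y = inner x (B y)" for x y
    using inB[of x y] inB[of y x] by (simp add: inner_commute)
  have psd: "inner (B x) x \<ge> 0" for x
  proof (cases "x = 0")
    case True
    then show ?thesis by simp
  next
    case False
    then have n1: "norm (x /\<^sub>R norm x) = 1" by simp
    have eq: "inner (B x) x = e * (l - (norm (A *v (x /\<^sub>R norm x)))\<^sup>2) * (norm x)\<^sup>2"
      unfolding inB power2_norm_eq_inner[symmetric] sphere_scale[of A x]
      by (simp add: power_mult_distrib algebra_simps)
    have "0 \<le> e * (l - (norm (A *v (x /\<^sub>R norm x)))\<^sup>2)"
    proof (cases "\<forall>w. norm w = 1 \<longrightarrow> norm (A *v w) \<le> norm (A *v u)")
      case True
      then have "e = 1" "norm (A *v (x /\<^sub>R norm x)) \<le> norm (A *v u)"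
        using n1 by (simp_all add: e_def)
      then show ?thesis by (simp add: l_def power_mono)
    next
      case False
      then have "e = - 1" "norm (A *v u) \<le> norm (A *v (x /\<^sub>R norm x))"
        using n1 ext by (auto simp add: e_def)
      then show ?thesis by (simp add: l_def power_mono)
    qed
    then show ?thesis by (simp add: eq)
  qed
  have z: "inner (B u) u = 0"
    unfolding inB power2_norm_eq_inner[symmetric] using u by (simp add: l_def)
  have "B u = 0" by (rule psd_kernel[OF lin sa psd z])
  then have "(transpose A ** A) *v u = l *\<^sub>R u"
    using e0 by (simp add: B_def)
  moreover have "u \<noteq> 0" using u by auto
  ultimately show ?thesis by (auto simp: singular_values_def l_def)
qed

lemma sphere_extrema:
  fixes A :: "real^'n^'m"
  obtains u v where "norm u = 1" "\<And>w. norm w = 1 \<Longrightarrow> norm (A *v w) \<le> norm (A *v u)"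
    "norm v = 1" "\<And>w. norm w = 1 \<Longrightarrow> norm (A *v v) \<le> norm (A *v w)"
proof -
  let ?S = "sphere (0 :: real^'n) 1"
  have c: "compact ?S" by simp
  have ne: "?S \<noteq> {}" by simp
  have co: "continuous_on ?S (\<lambda>w. norm (A *v w))"
    by (intro continuous_intros linear_continuous_on
        linear_conv_bounded_linear[THEN iffD1] matrix_vector_mul_linear)
  show ?thesis
    using continuous_attains_sup[OF c ne co] continuous_attains_inf[OF c ne co] that
    by (auto simp: dist_norm)
qed

lemma spectral_norm_eq_onorm:
  fixes A :: "real^'n^'m"
  shows "spectral_norm A = onorm ((*v) A)"
proof -
  obtain u v where u: "norm u = 1" "\<And>w. norm w = 1 \<Longrightarrow> norm (A *v w) \<le> norm (A *v u)"
    by (rule sphere_extrema[of A]) blast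
  have "spectral_norm A = norm (A *v u)"
    unfolding spectral_norm_def
  proof (rule Greatest_equality)
    show "norm (A *v u) \<in> singular_values A"
      using u by (intro extremal_singular_value) auto
    show "s \<le> norm (A *v u)" if "s \<in> singular_values A" for s
      using singular_value_attained[OF that] u(2) by metis
  qed
  moreover have "onorm ((*v) A) = norm (A *v u)"
  proof (rule antisym)
    show "onorm ((*v) A) \<le> norm (A *v u)"
    proof (rule onorm_bound)
      show "norm (A *v x) \<le> norm (A *v u) * norm x" for x
      proof (cases "x = 0")
        case False
        then show ?thesis
          using u(2)[of "x /\<^sub>R norm x"] by (subst sphere_scale) (simp add: mult_right_mono)
      qed simp
    qed simp
    show "norm (A *v u) \<le> onorm ((*v) A)"
      using onorm[OF matrix_vector_mul_bounded_linear, of A u] u(1) by simp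
  qed
  ultimately show ?thesis by simp
qed

lemma singular_min_least:
  fixes A :: "real^'n^'m"
  shows "singular_min A \<in> singular_values A"
    and "s \<in> singular_values A \<Longrightarrow> singular_min A \<le> s"
    and "singular_min A * norm x \<le> norm (A *v x)"
proof -
  obtain v where v: "norm v = 1" "\<And>w. norm w = 1 \<Longrightarrow> norm (A *v v) \<le> norm (A *v w)"
    by (rule sphere_extrema[of A]) blast
  have mem: "norm (A *v v) \<in> singular_values A"
    using v by (intro extremal_singular_value) auto
  have low: "norm (A *v v) \<le> s" if "s \<in> singular_values A" for s
    using singular_value_attained[OF that] v(2) by metis
  have eq: "singular_min A = norm (A *v v)"
    unfolding singular_min_def by (rule Least_equality) (fact mem, rule low)
  show "singular_min A \<in> singular_values A" using mem eq by simp
  show "singular_min A \<le> s" if "s \<in> singular_values A" using low[OF that] eq by simp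
  show "singular_min A * norm x \<le> norm (A *v x)"
  proof (cases "x = 0")
    case False
    then show ?thesis
      using v(2)[of "x /\<^sub>R norm x"] unfolding eq by (subst sphere_scale) (simp add: mult_right_mono)
  qed simp
qed

lemma gram_invertible:
  fixes A :: "real^'n^'m"
  assumes "rank A = CARD('n)"
  shows "invertible (transpose A ** A)"
proof -
  have inj: "inj ((*v) A)" using assms by (simp add: full_rank_injective)
  have "x = 0" if "(transpose A ** A) *v x = 0" for x
  proof -
    have "A *v x = 0" using gram_inner[of A x x] that by simp
    then show ?thesis using inj by (metis injD matrix_vector_mult_0_right)
  qed
  then show ?thesis
    by (metis invertible_left_inverse matrix_left_invertible_ker)
qed

lemma normal_equations:
  fixes A :: "real^'n^'m"
  assumes "rank A = CARD('n)"
  shows "inner (b - A *v lsq_solution A b) (A *v u) = 0"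
proof -
  let ?G = "transpose A ** A"
  have "?G ** matrix_inv ?G = mat 1"
    using gram_invertible[OF assms] unfolding invertible_def matrix_inv_def
    by (rule someI2_ex) simp
  then have "?G *v lsq_solution A b = transpose A *v b"
    by (simp add: lsq_solution_def matrix_vector_mul_assoc matrix_mul_assoc)
  then have "inner (A *v lsq_solution A b) (A *v u) = inner (transpose A *v b) u"
    by (metis gram_inner)
  also have "\<dots> = inner b (A *v u)"
    by (metis dot_lmul_matrix transpose_matrix_vector)
  finally show ?thesis by (simp add: inner_diff_left)
qed

lemma lsq_projection_eq: "lsq_projection A b = A *v lsq_solution A b"
  by (simp add: lsq_projection_def lsq_solution_def matrix_vector_mul_assoc matrix_mul_assoc
      del: transpose_matrix_vector)

lemma tan_subspace_angle:
  fixes A :: "real^'n^'m"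
  assumes full: "rank A = CARD('n)" and x: "lsq_solution A b \<noteq> 0"
  defines "p \<equiv> A *v lsq_solution A b"
  defines "t \<equiv> subspace_angle b (span (columns A))"
  shows "cos t = norm p / norm b" and "tan t = norm (b - p) / norm p"
proof -
  have inj: "inj ((*v) A)" using full by (simp add: full_rank_injective)
  have p0: "p \<noteq> 0" using x inj unfolding p_def by (metis injD matrix_vector_mult_0_right)
  have span: "span (columns A) = range ((*v) A)"
  proof (rule antisym)
    show "span (columns A) \<subseteq> range ((*v) A)"
      by (rule span_minimal)
        (auto simp: columns_image_basis intro!: linear_subspace_image[OF matrix_vector_mul_linear])
    show "range ((*v) A) \<subseteq> span (columns A)"
      by (auto intro: matrix_vector_mult_in_columnspace)
  qed
  have bw: "inner b (A *v u) = inner p (A *v u)" for u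
    using normal_equations[OF full, of b u] by (simp add: p_def inner_diff_left)
  have bp: "inner b p = (norm p)\<^sup>2"
    using bw[of "lsq_solution A b"] by (simp add: p_def power2_norm_eq_inner)
  have pyth: "(norm b)\<^sup>2 = (norm p)\<^sup>2 + (norm (b - p))\<^sup>2"
    using bp by (simp add: power2_norm_eq_inner inner_diff_left inner_diff_right inner_commute)
  have b0: "norm b > 0" using bp p0 by auto
  have pb: "norm p \<le> norm b"
    by (rule power2_le_imp_le) (simp_all add: pyth)
  have ang: "vec_angle b p = arccos (norm p / norm b)"
    using p0 by (simp add: vec_angle_def bp power2_eq_square)
  have t: "t = arccos (norm p / norm b)"
    unfolding t_def subspace_angle_def
  proof (rule Least_equality)
    show "\<exists>w\<in>span (columns A). w \<noteq> 0 \<and> arccos (norm p / norm b) = vec_angle b w"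
      using p0 ang span by (metis p_def rangeI)
    fix y assume "\<exists>w\<in>span (columns A). w \<noteq> 0 \<and> y = vec_angle b w"
    then obtain u where u: "A *v u \<noteq> 0" and y: "y = vec_angle b (A *v u)"
      by (auto simp: span)
    let ?q = "inner b (A *v u) / (norm b * norm (A *v u))"
    have "inner b (A *v u) \<le> norm p * norm (A *v u)"
      unfolding bw by (rule norm_cauchy_schwarz)
    then have q: "?q \<le> norm p / norm b"
      using u b0 by (simp add: divide_simps mult.commute)
    have "\<bar>inner b (A *v u)\<bar> \<le> norm b * norm (A *v u)"
      by (rule Cauchy_Schwarz_ineq2)
    then have "- (norm b * norm (A *v u)) \<le> inner b (A *v u)" by linarith
    then have "-1 \<le> ?q"
      using u b0 by (simp add: pos_le_divide_eq)
    then show "arccos (norm p / norm b) \<le> y"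
      unfolding y vec_angle_def using q pb b0 by (intro arccos_le_arccos) auto
  qed
  have le1: "norm p / norm b \<le> 1" using pb b0 by simp
  have ge: "-1 \<le> norm p / norm b" by (rule order_trans[of _ 0]) simp_all
  show c: "cos t = norm p / norm b"
    unfolding t using ge le1 by (rule cos_arccos)
  have "sin t = sqrt (1 - (norm p / norm b)\<^sup>2)"
    unfolding t using ge le1 by (rule sin_arccos)
  also have "1 - (norm p / norm b)\<^sup>2 = (norm (b - p) / norm b)\<^sup>2"
    using b0 pyth by (simp add: field_simps)
  finally have s: "sin t = norm (b - p) / norm b" by simp
  show "tan t = norm (b - p) / norm p"
    unfolding tan_def s c using b0 by simp
qed

end

theory Submission
  imports Defs
begin

text \<open>Write \<open>G = A\<^sup>t A\<close>, \<open>x = G\<inverse> A\<^sup>t b\<close> and \<open>r = b - A x\<close>. Differentiating the normal equations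
  \<open>M\<^sup>t (b - M x(M)) = 0\<close> at \<open>M = A\<close> in direction \<open>E\<close> gives
  \<open>J\<^sub>A E = (I - P) E x + A G\<inverse> E\<^sup>t r\<close>, a sum of two orthogonal vectors. Their norms are at most
  \<open>\<parallel>E\<parallel> \<parallel>x\<parallel>\<close> and \<open>\<parallel>E\<parallel> \<parallel>r\<parallel> / \<sigma>\<close>, where \<open>\<sigma>\<close> is the smallest singular value; this is the upper bound.
  Each of the two bounds is reached by a rank-one perturbation \<open>E = r z\<^sup>t\<close>: the first with
  \<open>z = x\<close>, the second with \<open>z\<close> a right singular vector for \<open>\<sigma>\<close>. The larger of two numbers is at
  least \<open>1 / \<surd>2\<close> times the root of the sum of their squares.\<close>

section \<open>Matrix-vector products\<close>

text \<open>Source of the product rule for \<open>M *v y\<close> with both factors varying, and of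
  the comparison between \<open>spectral_norm\<close> and the ambient matrix norm.\<close>

lemma bounded_bilinear_matrix_vector_mult:
  "bounded_bilinear (\<lambda>(M :: real^'n^'m) y. M *v y)"
  unfolding bilinear_conv_bounded_bilinear[symmetric] bilinear_def
  by (auto intro!: linearI
      simp: matrix_vector_mult_add_rdistrib matrix_vector_right_distrib
        scaleR_matrix_vector_assoc matrix_vector_mult_scaleR)

lemma bounded_linear_transpose: "bounded_linear (transpose :: real^'n^'m \<Rightarrow> real^'m^'n)"
  unfolding linear_conv_bounded_linear[symmetric]
  by (auto intro!: linearI simp: transpose_def vec_eq_iff)

lemma inner_transpose_left:
  fixes A :: "real^'n^'m"
  shows "inner (transpose A *v y) u = inner y (A *v u)"
  by (metis dot_lmul_matrix transpose_matrix_vector)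

lemma norm_matrix_vector_le_spectral_norm:
  fixes A :: "real^'n^'m"
  shows "norm (A *v u) \<le> spectral_norm A * norm u"
  unfolding spectral_norm_eq_onorm by (rule onorm[OF matrix_vector_mul_bounded_linear])

lemma spectral_norm_nonneg: "0 \<le> spectral_norm (A :: real^'n^'m)"
  unfolding spectral_norm_eq_onorm by (rule onorm_pos_le[OF matrix_vector_mul_bounded_linear])

lemma spectral_norm_pos:
  fixes A :: "real^'n^'m"
  assumes "A \<noteq> 0"
  shows "0 < spectral_norm A"
proof -
  have "\<not> (\<forall>u. A *v u = 0)"
    using assms by (metis matrix_eq matrix_vector_mult_0)
  then show ?thesis
    unfolding spectral_norm_eq_onorm
    by (simp add: onorm_pos_lt matrix_vector_mul_bounded_linear)
qed

lemma spectral_norm_scaleR: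
  fixes A :: "real^'n^'m"
  shows "spectral_norm (c *\<^sub>R A) = \<bar>c\<bar> * spectral_norm A"
  unfolding spectral_norm_eq_onorm
  using onorm_scaleR[OF matrix_vector_mul_bounded_linear, of c A]
  by (simp add: scaleR_matrix_vector_assoc)

text \<open>The triangle inequality and a bound by \<open>K\<close> times the ambient (Frobenius)
  norm make it Lipschitz. Continuity is what lets compactness produce a maximal gain.\<close>

lemma continuous_on_spectral_norm:
  "continuous_on S (spectral_norm :: real^'n^'m \<Rightarrow> real)"
proof -
  obtain K where K: "\<And>(M :: real^'n^'m) u. norm (M *v u) \<le> norm M * norm u * K" "0 \<le> K"
    using bounded_bilinear.nonneg_bounded[OF bounded_bilinear_matrix_vector_mult] by blast
  have le: "spectral_norm M \<le> norm M * K" for M :: "real^'n^'m"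
    unfolding spectral_norm_eq_onorm
    by (rule onorm_bound) (use K in \<open>auto simp: algebra_simps\<close>)
  have tri: "spectral_norm M \<le> spectral_norm N + K * dist M N" for M N :: "real^'n^'m"
  proof -
    have "spectral_norm (N + (M - N)) \<le> spectral_norm N + spectral_norm (M - N)"
      unfolding spectral_norm_eq_onorm matrix_vector_mult_add_rdistrib
      by (rule onorm_triangle) (rule matrix_vector_mul_bounded_linear)+
    then show ?thesis using le[of "M - N"] by (simp add: dist_norm mult.commute)
  qed
  have "K-lipschitz_on S (spectral_norm :: real^'n^'m \<Rightarrow> real)"
  proof (rule lipschitz_onI)
    fix M N :: "real^'n^'m"
    show "dist (spectral_norm M) (spectral_norm N) \<le> K * dist M N"
      using tri[of M N] tri[of N M] by (simp add: dist_real_def dist_commute abs_le_iff)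
  qed (rule K)
  then show ?thesis by (rule lipschitz_on_continuous_on)
qed

section \<open>Rank-one matrices\<close>

definition outer_product :: "real^'m \<Rightarrow> real^'n \<Rightarrow> real^'n^'m" where
  "outer_product y z = (\<chi> i j. y $ i * z $ j)"

lemma outer_product_mult: "outer_product y z *v u = inner z u *\<^sub>R y"
  by (simp add: outer_product_def matrix_vector_mult_def vec_eq_iff inner_vec_def
      sum_distrib_left sum_distrib_right mult_ac)

lemma transpose_outer_product: "transpose (outer_product y z) = outer_product z y"
  by (simp add: outer_product_def transpose_def vec_eq_iff mult.commute)

lemma outer_product_nonzero: "y \<noteq> 0 \<Longrightarrow> z \<noteq> 0 \<Longrightarrow> outer_product y z \<noteq> 0"
  by (auto simp: outer_product_def vec_eq_iff)

text \<open>Cauchy-Schwarz for \<open>inner z u\<close>. The upper bound is the useful direction,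
  because the size of a perturbation enters a denominator.\<close>

lemma spectral_norm_outer_product_le: "spectral_norm (outer_product y z) \<le> norm y * norm z"
  unfolding spectral_norm_eq_onorm
proof (rule onorm_bound)
  fix u
  show "norm (outer_product y z *v u) \<le> norm y * norm z * norm u"
    using mult_right_mono[OF Cauchy_Schwarz_ineq2[of z u] norm_ge_zero[of y]]
    by (simp add: outer_product_mult mult_ac)
qed simp

section \<open>Differentiability of solutions of linear systems\<close>

lemma differentiable_prod:
  fixes f :: "'i \<Rightarrow> 'a::real_normed_vector \<Rightarrow> real"
  assumes "\<And>i. i \<in> I \<Longrightarrow> f i differentiable (at a)"
  shows "(\<lambda>z. \<Prod>i\<in>I. f i z) differentiable (at a)"
proof -
  obtain f' where "\<And>i. i \<in> I \<Longrightarrow> (f i has_derivative f' i) (at a)"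
    using assms unfolding differentiable_def by metis
  then show ?thesis
    unfolding differentiable_def by (intro exI) (rule has_derivative_prod)
qed

text \<open>By the Leibniz formula the determinant is a finite sum of products of entries.\<close>

lemma differentiable_det:
  fixes F :: "'a::real_normed_vector \<Rightarrow> real^'n^'n"
  assumes "\<And>i j. (\<lambda>z. F z $ i $ j) differentiable (at a)"
  shows "(\<lambda>z. det (F z)) differentiable (at a)"
  unfolding det_def
  by (intro differentiable_sum ballI differentiable_mult differentiable_const differentiable_prod
      assms finite_permutations) simp

lemma differentiable_vec_nth:
  fixes f :: "'a::real_normed_vector \<Rightarrow> 'b::real_normed_vector^'n"
  assumes "f differentiable (at a)"
  shows "(\<lambda>z. f z $ i) differentiable (at a)"
proof -
  obtain f' where "(f has_derivative f') (at a)"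
    using assms unfolding differentiable_def by blast
  then show ?thesis
    unfolding differentiable_def
    by (intro exI) (rule bounded_linear.has_derivative[OF bounded_linear_vec_nth])
qed

text \<open>By Cramer's rule the solution is a quotient of polynomials in the entries.\<close>

lemma differentiable_linear_system:
  fixes F :: "'a::real_normed_vector \<Rightarrow> real^'n^'n" and y c :: "'a \<Rightarrow> real^'n"
  assumes F: "F differentiable (at a)" and c: "c differentiable (at a)"
    and det: "det (F a) \<noteq> 0"
    and solves: "\<And>z. det (F z) \<noteq> 0 \<Longrightarrow> F z *v y z = c z"
  shows "y differentiable (at a)"
proof -
  define q where
    "q z k = det (\<chi> i j. if j = k then c z $ i else F z $ i $ j) / det (F z)" for z k
  have dF: "(\<lambda>z. det (F z)) differentiable (at a)"
    by (intro differentiable_det differentiable_vec_nth F)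
  have "(\<lambda>z. q z k) differentiable (at a)" for k
    unfolding q_def
  proof (intro differentiable_divide dF det differentiable_det)
    fix i j
    show "(\<lambda>z. (\<chi> i j. if j = k then c z $ i else F z $ i $ j) $ i $ j) differentiable at a"
      by (cases "j = k") (simp_all add: differentiable_vec_nth F c)
  qed
  then have "(\<lambda>z. (\<chi> k. q z k) \<bullet> e) differentiable (at a)" if e: "e \<in> Basis" for e
  proof -
    obtain k where "e = axis k 1" using e by (auto simp: Basis_vec_def)
    then show ?thesis using \<open>\<And>k. (\<lambda>z. q z k) differentiable (at a)\<close>[of k]
      by (simp add: inner_axis)
  qed
  then have "(\<lambda>z. \<chi> k. q z k) differentiable (at a)"
    by (subst differentiable_componentwise_within) blast
  then obtain D where D: "((\<lambda>z. \<chi> k. q z k) has_derivative D) (at a)"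
    unfolding differentiable_def by blast
  have eq: "(\<chi> k. q z k) = y z" if "det (F z) \<noteq> 0" for z
    using cramer[OF that, of "y z" "c z"] solves[OF that] by (simp add: q_def)
  \<comment> \<open>Nothing is known about \<open>y\<close> where the determinant vanishes. By
    continuity this does not happen near \<open>a\<close>, so \<open>y\<close> agrees there with
    Cramer's quotient and inherits its derivative.\<close>
  have "\<forall>\<^sub>F z in at a. det (F z) \<noteq> 0"
    using tendsto_imp_eventually_ne[OF _ det] differentiable_imp_continuous_within[OF dF]
    by (simp add: continuous_within)
  then have "\<forall>\<^sub>F z in at a. (\<chi> k. q z k) = y z"
    by (rule eventually_mono) (rule eq)
  then have "(y has_derivative D) (at a)"
    using has_derivative_transform_eventually[OF D] eq[OF det] by simp
  then show ?thesis unfolding differentiable_def by blast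
qed

section \<open>The Jacobians of the projection\<close>

lemma matrix_inv_cancel:
  fixes M :: "real^'n^'n"
  assumes "invertible M"
  shows "M *v (matrix_inv M *v u) = u" and "matrix_inv M *v (M *v u) = u"
proof -
  have "M ** matrix_inv M = mat 1 \<and> matrix_inv M ** M = mat 1"
    using assms unfolding invertible_def matrix_inv_def by (rule someI2_ex) simp
  then show "M *v (matrix_inv M *v u) = u" "matrix_inv M *v (M *v u) = u"
    by (simp_all add: matrix_vector_mul_assoc)
qed

lemma lsq_solution_gram:
  fixes M :: "real^'n^'m"
  assumes "invertible (transpose M ** M)"
  shows "(transpose M ** M) *v lsq_solution M b = transpose M *v b"
  unfolding lsq_solution_def by (rule matrix_inv_cancel(1)[OF assms])

text \<open>Implicit differentiation in two stages: Cramer's rule provides some derivative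
  \<open>y'\<close>, then the differentiated normal equations form a linear system with invertible
  matrix \<open>A^t A\<close> that determines \<open>y'\<close>.\<close>

lemma lsq_solution_has_derivative:
  fixes A :: "real^'n^'m"
  assumes full: "rank A = CARD('n)"
  shows "((\<lambda>M. lsq_solution M b) has_derivative
    (\<lambda>E. matrix_inv (transpose A ** A) *v (transpose E *v (b - A *v lsq_solution A b))
         - lsq_solution A (E *v lsq_solution A b))) (at A)"
proof -
  note mv = bounded_bilinear.FDERIV[OF bounded_bilinear_matrix_vector_mult]
  let ?G = "\<lambda>M :: real^'n^'m. transpose M ** M"
  let ?y = "\<lambda>M. lsq_solution M b"
  have inv: "invertible (?G A)" by (rule gram_invertible[OF full])
  have tr: "((\<lambda>M :: real^'n^'m. transpose M) has_derivative transpose) (at A)"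
    by (rule bounded_linear.has_derivative[OF bounded_linear_transpose]) simp
  have bb: "bounded_bilinear (\<lambda>(M :: real^'m^'n) (N :: real^'n^'m). M ** N)"
    unfolding bilinear_conv_bounded_bilinear[symmetric] bilinear_def
    by (auto intro!: linearI simp: matrix_matrix_mult_def vec_eq_iff
        algebra_simps sum.distrib sum_distrib_left)
  have G: "?G differentiable (at A)"
    unfolding differentiable_def
    by (intro exI) (rule bounded_bilinear.FDERIV[OF bb tr has_derivative_ident])
  have c: "(\<lambda>M. transpose M *v b) differentiable (at A)"
    unfolding differentiable_def by (intro exI) (rule mv[OF tr has_derivative_const])
  have "?y differentiable (at A)"
  proof (rule differentiable_linear_system[OF G c])
    show "det (?G A) \<noteq> 0" using inv by (simp add: invertible_det_nz)
    show "?G M *v ?y M = transpose M *v b" if "det (?G M) \<noteq> 0" for M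
      using that by (intro lsq_solution_gram) (simp add: invertible_det_nz)
  qed
  then obtain y' where y': "(?y has_derivative y') (at A)"
    unfolding differentiable_def by blast
  let ?r = "b - A *v ?y A"
  \<comment> \<open>Product rule on \<open>M^t b - M^t (M y(M))\<close>; the terms containing
    \<open>transpose E\<close> combine into the residual.\<close>
  have N: "((\<lambda>M. transpose M *v b - ?G M *v ?y M) has_derivative
      (\<lambda>E. transpose E *v ?r - transpose A *v (E *v ?y A + A *v y' E))) (at A)"
    unfolding matrix_vector_mul_assoc[symmetric]
    by (rule has_derivative_eq_rhs, rule has_derivative_diff[OF mv[OF tr has_derivative_const]
            mv[OF tr mv[OF has_derivative_ident y']]])
      (simp add: fun_eq_iff matrix_vector_mult_diff_distrib matrix_vector_mult_0_right
        algebra_simps del: transpose_matrix_vector)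
  have dG: "(\<lambda>M. det (?G M)) differentiable (at A)"
    by (intro differentiable_det differentiable_vec_nth G)
  have "\<forall>\<^sub>F M in at A. det (?G M) \<noteq> 0"
    using tendsto_imp_eventually_ne[of "\<lambda>M. det (?G M)"] differentiable_imp_continuous_within[OF dG] inv
    by (simp add: continuous_within invertible_det_nz)
  then have ev: "\<forall>\<^sub>F M in at A. transpose M *v b - ?G M *v ?y M = 0"
    by (rule eventually_mono) (simp add: lsq_solution_gram invertible_det_nz)
  \<comment> \<open>The defect of the normal equations is zero at and near \<open>A\<close>, so the
    derivative in \<open>N\<close> is also one of the zero function; uniqueness makes it
    vanish.\<close>
  have "((\<lambda>M. 0) has_derivative
      (\<lambda>E. transpose E *v ?r - transpose A *v (E *v ?y A + A *v y' E))) (at A)"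
    by (rule has_derivative_transform_eventually[OF N ev]) (simp_all add: lsq_solution_gram inv)
  from has_derivative_unique[OF this has_derivative_const]
  have "transpose E *v ?r - transpose A *v (E *v ?y A + A *v y' E) = 0" for E
    by (simp add: fun_eq_iff del: transpose_matrix_vector)
  then have "?G A *v y' E = transpose E *v ?r - transpose A *v (E *v ?y A)" for E
    by (simp add: matrix_vector_mul_assoc[symmetric] matrix_vector_right_distrib algebra_simps
        del: transpose_matrix_vector)
  then have "y' E = matrix_inv (?G A) *v (transpose E *v ?r - transpose A *v (E *v ?y A))" for E
    by (metis matrix_inv_cancel(2)[OF inv])
  then have "y' = (\<lambda>E. matrix_inv (?G A) *v (transpose E *v ?r) - lsq_solution A (E *v ?y A))"
    by (simp add: fun_eq_iff lsq_solution_def matrix_vector_mult_diff_distrib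
        del: transpose_matrix_vector)
  with y' show ?thesis by simp
qed

text \<open>The product rule for \<open>M *v lsq_solution M b\<close>, regrouped so that the first
  summand is orthogonal to the column space of \<open>A\<close> and the second lies in it.\<close>

lemma lsq_projection_has_derivative:
  fixes A :: "real^'n^'m" and b :: "real^'m"
  assumes full: "rank A = CARD('n)"
  defines "x \<equiv> lsq_solution A b"
  shows "((\<lambda>M. lsq_projection M b) has_derivative
    (\<lambda>E. (E *v x - A *v lsq_solution A (E *v x))
         + A *v (matrix_inv (transpose A ** A) *v (transpose E *v (b - A *v x))))) (at A)"
  unfolding lsq_projection_eq
  by (rule has_derivative_eq_rhs, rule bounded_bilinear.FDERIV[OF
        bounded_bilinear_matrix_vector_mult has_derivative_ident
        lsq_solution_has_derivative[OF full]])
    (simp add: fun_eq_iff x_def matrix_vector_mult_diff_distrib algebra_simps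
      del: transpose_matrix_vector)

text \<open>For fixed \<open>A\<close> the projection is linear in \<open>b\<close>, hence its own
  derivative.\<close>

lemma J_b_eq: "J_b A b = lsq_projection A"
proof -
  have "lsq_projection A = (*v) (A ** matrix_inv (transpose A ** A) ** transpose A)"
    by (simp add: lsq_projection_def fun_eq_iff)
  then have "bounded_linear (lsq_projection A)"
    by (simp only: matrix_vector_mul_bounded_linear)
  then show ?thesis
    unfolding J_b_def
    by (intro frechet_derivative_at[symmetric] bounded_linear_imp_has_derivative)
qed

lemma J_A_eq:
  fixes A :: "real^'n^'m" and b :: "real^'m"
  assumes "rank A = CARD('n)"
  defines "x \<equiv> lsq_solution A b"
  shows "J_A A b E = (E *v x - A *v lsq_solution A (E *v x))
         + A *v (matrix_inv (transpose A ** A) *v (transpose E *v (b - A *v x)))"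
  using fun_cong[OF frechet_derivative_at[OF lsq_projection_has_derivative[OF assms(1), of b]], of E]
  by (simp add: J_A_def x_def)

lemma linear_J_A:
  fixes A :: "real^'n^'m"
  assumes "rank A = CARD('n)"
  shows "linear (J_A A b)"
  unfolding J_A_def
  by (rule linear_frechet_derivative)
    (use lsq_projection_has_derivative[OF assms] in \<open>auto simp: differentiable_def\<close>)

section \<open>Bounds for the derivative with respect to the matrix\<close>

lemma full_rank_mult_nonzero:
  fixes A :: "real^'n^'m"
  assumes "rank A = CARD('n)" and "u \<noteq> 0"
  shows "A *v u \<noteq> 0"
  using assms by (metis full_rank_injective injD matrix_vector_mult_0_right)

lemma singular_min_pos:
  fixes A :: "real^'n^'m"
  assumes "rank A = CARD('n)"
  shows "0 < singular_min A"
proof -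
  obtain u where u: "norm u = 1" "norm (A *v u) = singular_min A"
    using singular_value_attained[OF singular_min_least(1)[of A]] by blast
  have "u \<noteq> 0" using u(1) by auto
  then have "A *v u \<noteq> 0" by (rule full_rank_mult_nonzero[OF assms])
  with u show ?thesis by (metis zero_less_norm_iff)
qed

text \<open>Pythagoras, since the normal equations make residual and projection orthogonal. The
  first part serves the bound on \<open>J_A\<close>, the second the value of
  \<open>chi_b\<close>.\<close>

lemma norm_residual_le:
  fixes A :: "real^'n^'m"
  assumes "rank A = CARD('n)"
  shows "norm (c - A *v lsq_solution A c) \<le> norm c"
    and "norm (A *v lsq_solution A c) \<le> norm c"
proof -
  let ?p = "A *v lsq_solution A c"
  have "norm ((c - ?p) + ?p) ^ 2 = norm (c - ?p) ^ 2 + norm ?p ^ 2"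
    by (rule norm_add_Pythagorean) (simp add: orthogonal_def normal_equations[OF assms])
  then have eq: "norm c ^ 2 = norm (c - ?p) ^ 2 + norm ?p ^ 2" by simp
  show "norm (c - ?p) \<le> norm c" "norm ?p \<le> norm c"
    by (rule power2_le_imp_le; simp add: eq)+
qed

text \<open>For \<open>w\<close> the vector inside \<open>A *v\<close>, moving \<open>A\<close> and
  \<open>E\<close> across the inner product gives \<open>|A w|^2 = inner y (E w)\<close>. With
  \<open>|w| <= |A w| / \<sigma>\<close> one factor \<open>|A w|\<close> cancels, so no singular
  value decomposition is involved.\<close>

lemma norm_pseudoinverse_transpose_le:
  fixes A E :: "real^'n^'m"
  assumes full: "rank A = CARD('n)"
  shows "norm (A *v (matrix_inv (transpose A ** A) *v (transpose E *v y)))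
    \<le> spectral_norm E * (norm y / singular_min A)"
proof -
  define w where "w = matrix_inv (transpose A ** A) *v (transpose E *v y)"
  have \<sigma>: "0 < singular_min A" by (rule singular_min_pos[OF full])
  have w: "norm w \<le> norm (A *v w) / singular_min A"
    using singular_min_least(3)[of A w] \<sigma> by (simp add: field_simps)
  have "(norm (A *v w))\<^sup>2 = inner (transpose E *v y) w"
    using gram_inner[of A w w] matrix_inv_cancel(1)[OF gram_invertible[OF full]]
    by (simp add: w_def power2_norm_eq_inner del: transpose_matrix_vector)
  also have "\<dots> = inner y (E *v w)" by (rule inner_transpose_left)
  also have "\<dots> \<le> norm y * norm (E *v w)" by (rule norm_cauchy_schwarz)
  also have "\<dots> \<le> norm y * (spectral_norm E * norm w)"
    by (intro mult_left_mono norm_matrix_vector_le_spectral_norm) simp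
  also have "\<dots> \<le> norm y * (spectral_norm E * (norm (A *v w) / singular_min A))"
    by (intro mult_left_mono w spectral_norm_nonneg) simp
  finally have "norm (A *v w) * norm (A *v w)
      \<le> (spectral_norm E * (norm y / singular_min A)) * norm (A *v w)"
    by (simp add: power2_eq_square mult_ac)
  moreover have "0 \<le> spectral_norm E * (norm y / singular_min A)"
    using \<sigma> by (simp add: spectral_norm_nonneg)
  \<comment> \<open>If \<open>norm (A *v w)\<close> is zero there is nothing to cancel, and
    nonnegativity of the right side gives the claim.\<close>
  ultimately have "norm (A *v w) \<le> spectral_norm E * (norm y / singular_min A)"
    by (metis mult_right_le_imp_le norm_ge_zero order_le_less)
  then show ?thesis by (simp only: w_def)
qed

text \<open>Orthogonality lets the squares of the two bounds add; the triangle inequality would only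
  give the sum of the bounds.\<close>

lemma norm_J_A_le:
  fixes A E :: "real^'n^'m" and b :: "real^'m"
  assumes full: "rank A = CARD('n)"
  defines "x \<equiv> lsq_solution A b"
  shows "norm (J_A A b E)
    \<le> spectral_norm E * sqrt ((norm x)\<^sup>2 + (norm (b - A *v x) / singular_min A)\<^sup>2)"
proof -
  define g where "g = E *v x - A *v lsq_solution A (E *v x)"
  define h where "h = A *v (matrix_inv (transpose A ** A) *v (transpose E *v (b - A *v x)))"
  let ?\<rho> = "norm (b - A *v x) / singular_min A"
  have J: "J_A A b E = g + h"
    unfolding g_def h_def x_def by (rule J_A_eq[OF full])
  have "norm g \<le> spectral_norm E * norm x"
    using norm_residual_le(1)[OF full, of "E *v x"] norm_matrix_vector_le_spectral_norm[of E x]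
    by (simp add: g_def)
  moreover have "norm h \<le> spectral_norm E * ?\<rho>"
    unfolding h_def by (rule norm_pseudoinverse_transpose_le[OF full])
  ultimately have "(norm g)\<^sup>2 + (norm h)\<^sup>2
      \<le> (spectral_norm E * norm x)\<^sup>2 + (spectral_norm E * ?\<rho>)\<^sup>2"
    by (intro add_mono power_mono) simp_all
  moreover have "(norm (g + h))\<^sup>2 = (norm g)\<^sup>2 + (norm h)\<^sup>2"
    by (rule norm_add_Pythagorean) (simp add: orthogonal_def g_def h_def normal_equations[OF full])
  ultimately have "(norm (J_A A b E))\<^sup>2 \<le> (spectral_norm E)\<^sup>2 * ((norm x)\<^sup>2 + ?\<rho>\<^sup>2)"
    by (simp only: J power_mult_distrib distrib_left)
  then have "norm (J_A A b E) \<le> sqrt ((spectral_norm E)\<^sup>2 * ((norm x)\<^sup>2 + ?\<rho>\<^sup>2))"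
    by (rule real_le_rsqrt)
  then show ?thesis by (simp add: real_sqrt_mult spectral_norm_nonneg)
qed

text \<open>For \<open>E = r z^t\<close>, the vector \<open>E x\<close> is a multiple of
  \<open>r\<close>, whose projection is zero, and \<open>E^t r\<close> is
  \<open>|r|^2 z\<close>.\<close>

lemma J_A_outer_product:
  fixes A :: "real^'n^'m" and b :: "real^'m"
  assumes full: "rank A = CARD('n)"
  defines "x \<equiv> lsq_solution A b" and "r \<equiv> b - A *v lsq_solution A b"
  shows "J_A A b (outer_product r z)
    = inner z x *\<^sub>R r + (norm r)\<^sup>2 *\<^sub>R (A *v (matrix_inv (transpose A ** A) *v z))"
proof -
  \<comment> \<open>Testing the normal equations with \<open>u = A^t r\<close> shows that
    \<open>A^t r\<close> has inner product zero with itself.\<close>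
  have "transpose A *v r = 0"
    using normal_equations[OF full, of b "transpose A *v r"] inner_transpose_left[of A r]
    by (metis inner_eq_zero_iff r_def)
  then have "lsq_solution A (t *\<^sub>R r) = 0" for t
    by (simp add: lsq_solution_def matrix_vector_mult_scaleR matrix_vector_mult_0_right
        del: transpose_matrix_vector)
  then show ?thesis
    unfolding J_A_eq[OF full] r_def[symmetric]
    unfolding x_def[symmetric] transpose_outer_product outer_product_mult
    by (simp add: matrix_vector_mult_scaleR power2_norm_eq_inner)
qed

text \<open>By Pythagoras either orthogonal summand alone bounds the norm from below. For
  \<open>z = x\<close> the first is kept, for \<open>z = v\<close>, an eigenvector of
  \<open>A^t A\<close> to \<open>\<sigma>^2\<close>, the second.\<close>

lemma J_A_gain_ge:
  fixes A :: "real^'n^'m" and b :: "real^'m"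
  assumes full: "rank A = CARD('n)"
  defines "x \<equiv> lsq_solution A b" and "r \<equiv> b - A *v lsq_solution A b"
  assumes x0: "x \<noteq> 0" and r0: "r \<noteq> 0"
  obtains E F where "E \<noteq> 0" "norm x \<le> norm (J_A A b E) / spectral_norm E"
    and "F \<noteq> 0" "norm r / singular_min A \<le> norm (J_A A b F) / spectral_norm F"
proof -
  let ?\<sigma> = "singular_min A"
  let ?inv = "\<lambda>z. matrix_inv (transpose A ** A) *v z"
  have pyth: "(norm (J_A A b (outer_product r z)))\<^sup>2
      = (inner z x * norm r)\<^sup>2 + ((norm r)\<^sup>2 * norm (A *v ?inv z))\<^sup>2" for z
  proof -
    have "orthogonal (inner z x *\<^sub>R r) ((norm r)\<^sup>2 *\<^sub>R (A *v ?inv z))"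
      by (simp add: orthogonal_def r_def normal_equations[OF full])
    from norm_add_Pythagorean[OF this] show ?thesis
      unfolding J_A_outer_product[OF full, of b z] x_def r_def
      by (simp add: power_mult_distrib)
  qed
  have gain: "k \<le> norm (J_A A b (outer_product r z)) / spectral_norm (outer_product r z)"
    if z: "z \<noteq> 0" and k: "0 \<le> k"
      and le: "k * (norm r * norm z) \<le> norm (J_A A b (outer_product r z))" for z k
  proof -
    have "0 < spectral_norm (outer_product r z)"
      by (intro spectral_norm_pos outer_product_nonzero r0 z)
    moreover have "k * spectral_norm (outer_product r z) \<le> k * (norm r * norm z)"
      by (intro mult_left_mono spectral_norm_outer_product_le k)
    ultimately show ?thesis using le by (simp add: pos_le_divide_eq)
  qed
  have x_gain: "norm x \<le> norm (J_A A b (outer_product r x)) / spectral_norm (outer_product r x)"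
  proof (rule gain[OF x0 norm_ge_zero], rule power2_le_imp_le)
    show "(norm x * (norm r * norm x))\<^sup>2 \<le> (norm (J_A A b (outer_product r x)))\<^sup>2"
      unfolding pyth by (simp add: power2_norm_eq_inner[symmetric] power2_eq_square mult_ac)
  qed simp
  obtain v where v: "v \<noteq> 0" and ev: "(transpose A ** A) *v v = ?\<sigma>\<^sup>2 *\<^sub>R v"
    using singular_min_least(1)[of A] by (auto simp: singular_values_def)
  have \<sigma>: "0 < ?\<sigma>" by (rule singular_min_pos[OF full])
  have "(norm (A *v v))\<^sup>2 = (?\<sigma> * norm v)\<^sup>2"
    using gram_inner[of A v v] by (simp add: ev power_mult_distrib power2_norm_eq_inner)
  then have nv: "norm (A *v v) = ?\<sigma> * norm v"
    using \<sigma> by (simp add: power2_eq_iff_nonneg)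
  have "?\<sigma>\<^sup>2 *\<^sub>R ?inv v = v"
    using matrix_inv_cancel(2)[OF gram_invertible[OF full], of v]
    by (simp add: ev matrix_vector_mult_scaleR)
  then have "?inv v = (1 / ?\<sigma>\<^sup>2) *\<^sub>R v"
    using \<sigma> by (metis inverse_eq_divide less_irrefl scaleR_one scaleR_scaleR left_inverse
        zero_eq_power2)
  then have "norm (A *v ?inv v) = norm v / ?\<sigma>"
    using \<sigma> nv by (simp add: matrix_vector_mult_scaleR power2_eq_square)
  then have eq: "(norm r)\<^sup>2 * norm (A *v ?inv v) = norm r / ?\<sigma> * (norm r * norm v)"
    by (simp add: power2_eq_square)
  have v_gain: "norm r / ?\<sigma> \<le> norm (J_A A b (outer_product r v)) / spectral_norm (outer_product r v)"
  proof (rule gain[OF v])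
    show "0 \<le> norm r / ?\<sigma>" using \<sigma> by simp
    show "norm r / ?\<sigma> * (norm r * norm v) \<le> norm (J_A A b (outer_product r v))"
      unfolding eq[symmetric] by (rule power2_le_imp_le) (simp_all add: pyth)
  qed
  show ?thesis
    by (rule that[OF outer_product_nonzero[OF r0 x0] x_gain outer_product_nonzero[OF r0 v] v_gain])
qed

section \<open>The condition numbers\<close>

text \<open>The quotient is invariant under scaling of \<open>M\<close>, so its maximum over the
  compact unit sphere of the ambient norm is global. This gives the \<open>GREATEST\<close> in
  \<open>chi_A\<close> its meaning.\<close>

lemma linear_gain_attains_max:
  fixes f :: "real^'n^'m \<Rightarrow> 'b::real_normed_vector"
  assumes f: "linear f"
  obtains E where "E \<noteq> 0"
    "\<And>M. M \<noteq> 0 \<Longrightarrow> norm (f M) / spectral_norm M \<le> norm (f E) / spectral_norm E"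
proof -
  let ?q = "\<lambda>M. norm (f M) / spectral_norm M"
  have pos: "spectral_norm M \<noteq> 0" if "norm M = 1" for M :: "real^'n^'m"
    using spectral_norm_pos[of M] that by force
  have "continuous_on (sphere 0 1) ?q"
    by (intro continuous_intros continuous_on_spectral_norm linear_continuous_on)
      (use pos f in \<open>auto simp: linear_conv_bounded_linear\<close>)
  then obtain E where E: "norm E = 1" and max: "\<And>M. norm M = 1 \<Longrightarrow> ?q M \<le> ?q E"
    using continuous_attains_sup[of "sphere 0 1 :: (real^'n^'m) set" ?q] by auto
  show ?thesis
  proof
    show "E \<noteq> 0" using E by auto
    fix M :: "real^'n^'m" assume M: "M \<noteq> 0"
    then have "?q M = ?q (M /\<^sub>R norm M)"
      by (simp add: linear_scale[OF f] spectral_norm_scaleR)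
    also have "\<dots> \<le> ?q E" using M by (intro max) simp
    finally show "?q M \<le> ?q E" .
  qed
qed

lemma chi_A_attained:
  fixes A :: "real^'n^'m" and b :: "real^'m"
  assumes full: "rank A = CARD('n)"
  defines "s \<equiv> spectral_norm A / norm (A *v lsq_solution A b)"
  obtains E where "E \<noteq> 0" "chi_A A b = s * (norm (J_A A b E) / spectral_norm E)"
    "\<And>M. M \<noteq> 0 \<Longrightarrow> s * (norm (J_A A b M) / spectral_norm M) \<le> chi_A A b"
proof -
  obtain E where E: "E \<noteq> 0" and max:
    "\<And>M. M \<noteq> 0 \<Longrightarrow> norm (J_A A b M) / spectral_norm M \<le> norm (J_A A b E) / spectral_norm E"
    using linear_gain_attains_max[OF linear_J_A[OF full]] by blast
  have s0: "0 \<le> s" by (simp add: s_def spectral_norm_nonneg)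
  \<comment> \<open>This holds for every \<open>M\<close>, zero included, because division by zero
    yields zero; hence it can rewrite under the quantifier.\<close>
  have q: "(norm (J_A A b M) / norm (A *v lsq_solution A b)) / (spectral_norm M / spectral_norm A)
      = s * (norm (J_A A b M) / spectral_norm M)" for M
    by (simp add: s_def mult_ac)
  have "chi_A A b = s * (norm (J_A A b E) / spectral_norm E)"
    unfolding chi_A_def q
    by (rule Greatest_equality) (use E mult_left_mono[OF max s0] in blast)+
  then show ?thesis using that[OF E] mult_left_mono[OF max s0] by simp
qed

text \<open>An orthogonal projection never increases the norm, and it fixes the nonzero vector
  \<open>A x\<close>, so its maximal gain is 1.\<close>

lemma chi_b_eq:
  fixes A :: "real^'n^'m" and b :: "real^'m"
  assumes full: "rank A = CARD('n)" and x0: "lsq_solution A b \<noteq> 0"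
  shows "chi_b A b = norm b / norm (A *v lsq_solution A b)"
proof -
  let ?p = "A *v lsq_solution A b"
  have p0: "?p \<noteq> 0" by (rule full_rank_mult_nonzero[OF full x0])
  have "transpose A *v ?p = (transpose A ** A) *v lsq_solution A b"
    by (rule matrix_vector_mul_assoc)
  then have "lsq_solution A ?p = lsq_solution A b"
    by (simp only: lsq_solution_def[of A ?p] matrix_inv_cancel(2)[OF gram_invertible[OF full]])
  then have idem: "J_b A b ?p = ?p" by (simp add: J_b_eq lsq_projection_eq)
  show ?thesis
    unfolding chi_b_def
  proof (rule Greatest_equality)
    show "\<exists>\<Delta>b. \<Delta>b \<noteq> 0 \<and> norm b / norm ?p
        = (norm (J_b A b \<Delta>b) / norm ?p) / (norm \<Delta>b / norm b)"
      by (rule exI[of _ ?p]) (use p0 idem in simp)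
    fix c assume "\<exists>\<Delta>b. \<Delta>b \<noteq> 0 \<and> c = (norm (J_b A b \<Delta>b) / norm ?p) / (norm \<Delta>b / norm b)"
    then obtain d where d: "d \<noteq> 0"
      and c: "c = (norm b / norm ?p) * (norm (J_b A b d) / norm d)"
      by (auto simp: mult_ac)
    have "norm (J_b A b d) / norm d \<le> 1"
      using norm_residual_le(2)[OF full, of d] d by (simp add: J_b_eq lsq_projection_eq)
    then show "c \<le> norm b / norm ?p"
      unfolding c by (intro mult_left_le) simp_all
  qed
qed

theorem mainTheorem2:
  fixes A :: "real^'n^'m" and b r :: "real^'m" and x :: "real^'n"
    and \<sigma>_min \<kappa>\<^sub>2 v \<theta> :: real
  assumes full_column_rank: "rank A = CARD('n)"
    and x: "x = lsq_solution A b"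
    and r: "r = b - A *v x"
    and "x \<noteq> 0" and "r \<noteq> 0"
    and \<sigma>_min: "\<sigma>_min = singular_min A"
    and \<kappa>\<^sub>2: "\<kappa>\<^sub>2 = spectral_norm A / \<sigma>_min"
    and v: "v = norm (A *v x) / (norm x * \<sigma>_min)"
    and \<theta>: "\<theta> = subspace_angle b (span (columns A))"
  shows "chi_b A b = 1 / cos \<theta>
    \<and> 1 / sqrt 2 * \<kappa>\<^sub>2 * sqrt ((tan \<theta>)\<^sup>2 + 1 / v\<^sup>2) \<le> chi_A A b
    \<and> chi_A A b \<le> \<kappa>\<^sub>2 * sqrt ((tan \<theta>)\<^sup>2 + 1 / v\<^sup>2)"
proof (intro conjI)
  note full = full_column_rank
  have x0: "lsq_solution A b \<noteq> 0" using \<open>x \<noteq> 0\<close> x by simp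
  have r': "r = b - A *v lsq_solution A b" using r x by simp
  have cos: "cos \<theta> = norm (A *v x) / norm b" and tan: "tan \<theta> = norm r / norm (A *v x)"
    using tan_subspace_angle[OF full x0] by (simp_all add: \<theta> x r)
  show "chi_b A b = 1 / cos \<theta>"
    using chi_b_eq[OF full x0] by (simp add: cos x)
  define s where "s = spectral_norm A / norm (A *v x)"
  define \<rho> where "\<rho> = norm r / \<sigma>_min"
  have \<sigma>: "0 < \<sigma>_min" using singular_min_pos[OF full] \<sigma>_min by simp
  have p: "0 < norm (A *v x)" using full_rank_mult_nonzero[OF full] \<open>x \<noteq> 0\<close> by simp
  have s: "0 \<le> s" by (simp add: s_def spectral_norm_nonneg)
  have \<rho>: "0 \<le> \<rho>" using \<sigma> by (simp add: \<rho>_def)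
  \<comment> \<open>Here \<open>1 / v\<close> is
    \<open>norm x * \<sigma>_min / norm (A *v x)\<close>. The extracted \<open>\<sigma>_min\<close>
    cancels the one in \<open>\<kappa>\<^sub>2\<close>, so both claims compare \<open>chi_A\<close>
    with \<open>s\<close> times the same root.\<close>
  have "(tan \<theta>)\<^sup>2 + 1 / v\<^sup>2 = (\<sigma>_min / norm (A *v x))\<^sup>2 * ((norm x)\<^sup>2 + \<rho>\<^sup>2)"
    using \<sigma> p \<open>x \<noteq> 0\<close> by (simp add: tan v \<rho>_def field_simps)
  then have "sqrt ((tan \<theta>)\<^sup>2 + 1 / v\<^sup>2)
      = \<sigma>_min / norm (A *v x) * sqrt ((norm x)\<^sup>2 + \<rho>\<^sup>2)"
    using \<sigma> by (simp add: real_sqrt_mult)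
  then have bound: "\<kappa>\<^sub>2 * sqrt ((tan \<theta>)\<^sup>2 + 1 / v\<^sup>2) = s * sqrt ((norm x)\<^sup>2 + \<rho>\<^sup>2)"
    using \<sigma> by (simp add: \<kappa>\<^sub>2 s_def)
  obtain E where E: "E \<noteq> 0"
    and chi: "chi_A A b = s * (norm (J_A A b E) / spectral_norm E)"
    and max: "\<And>M. M \<noteq> 0 \<Longrightarrow> s * (norm (J_A A b M) / spectral_norm M) \<le> chi_A A b"
    using chi_A_attained[OF full, of b] unfolding s_def x by blast
  have "norm (J_A A b E) / spectral_norm E \<le> sqrt ((norm x)\<^sup>2 + \<rho>\<^sup>2)"
    using norm_J_A_le[OF full, of b E] spectral_norm_pos[OF E]
    by (simp add: pos_divide_le_eq mult.commute \<rho>_def r \<sigma>_min flip: x)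
  then show "chi_A A b \<le> \<kappa>\<^sub>2 * sqrt ((tan \<theta>)\<^sup>2 + 1 / v\<^sup>2)"
    unfolding bound chi by (intro mult_left_mono s)
  obtain M N where M: "M \<noteq> 0" "norm x \<le> norm (J_A A b M) / spectral_norm M"
    and N: "N \<noteq> 0" "\<rho> \<le> norm (J_A A b N) / spectral_norm N"
    using J_A_gain_ge[OF full x0] \<open>r \<noteq> 0\<close> unfolding \<rho>_def r' x \<sigma>_min by metis
  have lower: "s * norm x \<le> chi_A A b" "s * \<rho> \<le> chi_A A b"
    using mult_left_mono[OF M(2) s] max[OF M(1)] mult_left_mono[OF N(2) s] max[OF N(1)]
    by linarith+
  \<comment> \<open>Each square is at most the square of \<open>chi_A\<close>; this doubling is the
    origin of \<open>1 / sqrt 2\<close>.\<close>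
  have "(s * norm x)\<^sup>2 + (s * \<rho>)\<^sup>2 \<le> 2 * (chi_A A b)\<^sup>2"
    using power_mono[OF lower(1), of 2] power_mono[OF lower(2), of 2] s \<rho> by simp
  then have "s\<^sup>2 * ((norm x)\<^sup>2 + \<rho>\<^sup>2) \<le> 2 * (chi_A A b)\<^sup>2"
    by (simp add: power_mult_distrib distrib_left)
  then have "sqrt (s\<^sup>2 * ((norm x)\<^sup>2 + \<rho>\<^sup>2)) \<le> sqrt (2 * (chi_A A b)\<^sup>2)"
    by (rule real_sqrt_le_mono)
  \<comment> \<open>The sign is needed for the root of the square of \<open>chi_A\<close> to be
    \<open>chi_A\<close> itself.\<close>
  moreover have "0 \<le> chi_A A b" using lower(2) s \<rho> by (meson mult_nonneg_nonneg order_trans)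
  ultimately have "s * sqrt ((norm x)\<^sup>2 + \<rho>\<^sup>2) \<le> sqrt 2 * chi_A A b"
    using s by (simp add: real_sqrt_mult)
  then show "1 / sqrt 2 * \<kappa>\<^sub>2 * sqrt ((tan \<theta>)\<^sup>2 + 1 / v\<^sup>2) \<le> chi_A A b"
    unfolding mult.assoc bound by (simp add: pos_divide_le_eq mult.commute)
qed

end
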